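(* Assume $\alpha>0$ and $\beta>0$. Let $p$ be a probability measure on $\Omega$ and let $\mathcal{F}(q_\theta)=\frac12\mathrm{MMD}(p,q_\theta)^2$. Let $t\mapsto\theta_t\in\Theta$ be a solution of the dynamic $$\frac{d\theta_t}{dt}=L_{\theta_t}(f_t),\qquad\text{where } f_t\in\mathcal{H}\text{ is the unique solution of }\ (\alpha D_{\theta_t}+\beta I)f_t=\mu_{p-q_{\theta_t}} .$$ Then this dynamic decreases the functional $\mathcal{F}(q_\theta)$: $$\frac{d\mathcal{F}(q_{\theta_t})}{dt}=-\frac{2}{\alpha}\Big[\mathcal{F}(q_{\theta_t})-\beta\,\mathrm{MMD}_{\alpha,\beta}(p,q_{\theta_t})^2\Big]\le 0 .$$ Moreover, $\frac{d\mathcal{F}(q_{\theta_t})}{dt}<0$ if and only if $D_{\theta_t}\mu_{p-q_{\theta_t}}\neq 0$.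
   Context: Setting. $\Omega\subset\mathbb{R}^d$ is open and $\mathcal{H}$ is a reproducing kernel Hilbert space of real functions on $\Omega$ with bounded kernel $k$; $\langle\cdot,\cdot\rangle_{\mathcal H},\|\cdot\|_{\mathcal H}$ are its inner product and norm, and $\langle\cdot,\cdot\rangle,\|\cdot\|$ the Euclidean ones. The map $x\mapsto k(x,\cdot)\in\mathcal H$ is differentiable, $\nabla_x k(x,\cdot)\in\mathcal{H}^d$ is its gradient (in the first argument), so $\nabla f(x)=\langle f,\nabla_x k(x,\cdot)\rangle_{\mathcal H}$ for $f\in\mathcal H$. $\mathcal{Z}\subset\mathbb{R}^m$ is open with a probability distribution $\nu$; $\Theta\subset\mathbb{R}^n$ is a parameter space (all parameter points under consideration are understood to lie in $\Theta$); $G_\theta=(G_\theta^1,\dots,G_\theta^d):\mathcal Z\to\Omega$ is differentiable in $\theta$. It is assumed that $\|k(x,\cdot)-k(y,\cdot)\|_{\mathcal H}\le L\|x-y\|$ and $\|G_\theta(z)-G_{\theta'}(z)\|\le D(z)\|\theta-\theta'\|$ for a constant $L>0$ and a function $D:\mathcal Z\to[0,\infty)$ with $\mathbb{E}_\nu[D(z)^2]<\infty$. Put $q_\theta=(G_\theta)_\#\nu$ (push-forward). For a probability distribution $\rho$ on $\Omega$, $\mu_\rho(x)=\int k(x,y)\rho(dy)\in\mathcal H$ is the kernel mean embedding, and $\mu_{\rho_1-\rho_2}=\mu_{\rho_1}-\mu_{\rho_2}$. $\mathrm{MMD}(p,q)=\|\mu_p-\mu_q\|_{\mathcal H}$. Operators.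 $J_\theta G_\theta(z)=\big(\partial G_\theta^j(z)/\partial\theta_i\big)_{ij}\in\mathbb{R}^{n\times d}$. $L_\theta:\mathcal H\to\mathbb{R}^n$, $L_\theta(f)=\int J_\theta G_\theta(z)\nabla f(G_\theta(z))\,\nu(dz)$; $L_\theta^\top:\mathbb{R}^n\to\mathcal H$, $L_\theta^\top(v)=\int\langle\nabla_x k(G_\theta(z),\cdot),J_\theta G_\theta(z)^\top v\rangle\,\nu(dz)$; $D_\theta=L_\theta^\top L_\theta:\mathcal H\to\mathcal H$, which is symmetric and positive semidefinite; $I$ is the identity on $\mathcal H$, and $\alpha D_\theta+\beta I$ is invertible for $\alpha\ge0,\beta>0$. Regularized discrepancy: $\mathrm{MMD}_{\alpha,\beta}(p,q_\theta)=\sup_{f\in E_{\alpha,\beta}}\{\int f\,dp-\int f\,dq_\theta\}$, where $E_{\alpha,\beta}=\{f\in\mathcal H:\ \alpha\|\nabla_\theta\int f(x)q_\theta(dx)\|^2+\beta\|f\|_{\mathcal H}^2\le\frac12\}$. *)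

theory Defs
  imports "HOL-Analysis.Analysis" "HOL-Probability.Probability_Measure"
begin

text \<open>
  A Hilbert space of real functions on \<open>\<Omega>\<close> is given by a Hilbert space type \<open>'h\<close> together with
  \<open>ev f x\<close>, the value of the function \<open>f :: 'h\<close> at the point \<open>x\<close>; only values on \<open>\<Omega>\<close> matter.
  By \<open>ev_inject\<close> the elements of \<open>'h\<close> are determined by their values on \<open>\<Omega>\<close>.
  By \<open>kernel\<close>, which is membership of \<open>k(x,\<cdot>)\<close> in the space and the reproducing property,
  the vector space operations of \<open>'h\<close> are the pointwise ones.
\<close>

locale rkhs =
  fixes \<Omega> :: "(real^'d) set"
    and ev :: "'h::{real_inner, complete_space} \<Rightarrow> real^'d \<Rightarrow> real"
    and k :: "real^'d \<Rightarrow> real^'d \<Rightarrow> real"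
  assumes ev_inject: "(\<And>x. x \<in> \<Omega> \<Longrightarrow> ev f x = ev g x) \<Longrightarrow> f = g"
    and kernel: "x \<in> \<Omega> \<Longrightarrow> \<exists>h. (\<forall>y\<in>\<Omega>. ev h y = k x y) \<and> (\<forall>f. ev f x = inner f h)"

definition elem_of :: "(real^'d) set \<Rightarrow> ('h \<Rightarrow> real^'d \<Rightarrow> real) \<Rightarrow> (real^'d \<Rightarrow> real) \<Rightarrow> 'h" where
  "elem_of \<Omega> ev \<phi> = (THE h. \<forall>x\<in>\<Omega>. ev h x = \<phi> x)"

text \<open>\<open>ksec \<Omega> ev k x\<close> is \<open>k(x,\<cdot>)\<close> as an element of the Hilbert space.\<close>

definition ksec ::
  "(real^'d) set \<Rightarrow> ('h \<Rightarrow> real^'d \<Rightarrow> real) \<Rightarrow> (real^'d \<Rightarrow> real^'d \<Rightarrow> real) \<Rightarrow> real^'d \<Rightarrow> 'h" where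
  "ksec \<Omega> ev k x = elem_of \<Omega> ev (k x)"

definition kgrad ::
  "(real^'d) set \<Rightarrow> ('h::real_normed_vector \<Rightarrow> real^'d \<Rightarrow> real) \<Rightarrow> (real^'d \<Rightarrow> real^'d \<Rightarrow> real)
    \<Rightarrow> real^'d \<Rightarrow> 'h^'d" where
  "kgrad \<Omega> ev k x = (\<chi> j. frechet_derivative (ksec \<Omega> ev k) (at x) (axis j 1))"

definition grad :: "('a::real_inner \<Rightarrow> real) \<Rightarrow> 'a filter \<Rightarrow> 'a" where
  "grad \<phi> F = (THE g. (\<phi> has_derivative (\<lambda>h. inner g h)) F)"

definition mean_embedding ::
  "(real^'d) set \<Rightarrow> ('h \<Rightarrow> real^'d \<Rightarrow> real) \<Rightarrow> (real^'d \<Rightarrow> real^'d \<Rightarrow> real)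
    \<Rightarrow> (real^'d) measure \<Rightarrow> 'h" where
  "mean_embedding \<Omega> ev k \<rho> = elem_of \<Omega> ev (\<lambda>x. \<integral>y. k x y \<partial>\<rho>)"

definition mmd ::
  "(real^'d) set \<Rightarrow> ('h::real_normed_vector \<Rightarrow> real^'d \<Rightarrow> real) \<Rightarrow> (real^'d \<Rightarrow> real^'d \<Rightarrow> real)
    \<Rightarrow> (real^'d) measure \<Rightarrow> (real^'d) measure \<Rightarrow> real" where
  "mmd \<Omega> ev k p q = norm (mean_embedding \<Omega> ev k p - mean_embedding \<Omega> ev k q)"

text \<open>
  In a generator \<open>G \<theta> z\<close> the first argument is the parameter. Derivatives with respect to \<open>\<theta>\<close> are
  taken within the parameter set \<open>\<Theta>\<close>. The assumption \<open>parameter_directions\<close> says that the partial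
  derivatives at points of \<open>\<Theta>\<close> are meaningful, that is, derivatives within \<open>\<Theta>\<close> are unique; it
  holds in particular when \<open>\<Theta>\<close> is open.
\<close>

locale generator_setting = rkhs \<Omega> ev k
  for \<Omega> :: "(real^'d) set"
    and ev :: "'h::{real_inner, complete_space} \<Rightarrow> real^'d \<Rightarrow> real"
    and k :: "real^'d \<Rightarrow> real^'d \<Rightarrow> real" +
  fixes Z :: "(real^'m) set"
    and \<nu> :: "(real^'m) measure"
    and \<Theta> :: "(real^'n) set"
    and G :: "real^'n \<Rightarrow> real^'m \<Rightarrow> real^'d"
    and Lip :: real
    and D :: "real^'m \<Rightarrow> real"
  assumes open_\<Omega>: "open \<Omega>"
    and bounded_kernel: "\<exists>C. \<forall>x\<in>\<Omega>. \<forall>y\<in>\<Omega>. \<bar>k x y\<bar> \<le> C"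
    and kernel_differentiable: "x \<in> \<Omega> \<Longrightarrow> ksec \<Omega> ev k differentiable (at x)"
    and Lip_pos: "Lip > 0"
    and kernel_lipschitz:
      "x \<in> \<Omega> \<Longrightarrow> y \<in> \<Omega> \<Longrightarrow> norm (ksec \<Omega> ev k x - ksec \<Omega> ev k y) \<le> Lip * norm (x - y)"
    and open_Z: "open Z"
    and prob_\<nu>: "prob_space \<nu>"
    and sets_\<nu>: "sets \<nu> = sets (restrict_space borel Z)"
    and parameter_directions:
      "\<theta> \<in> \<Theta> \<Longrightarrow> e > 0 \<Longrightarrow> \<exists>s. 0 < \<bar>s\<bar> \<and> \<bar>s\<bar> < e \<and> \<theta> + s *\<^sub>R axis i 1 \<in> \<Theta>"
    and G_measurable: "\<theta> \<in> \<Theta> \<Longrightarrow> G \<theta> \<in> measurable \<nu> (restrict_space borel \<Omega>)"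
    and G_differentiable:
      "\<theta> \<in> \<Theta> \<Longrightarrow> z \<in> Z \<Longrightarrow> (\<lambda>\<theta>'. G \<theta>' z) differentiable (at \<theta> within \<Theta>)"
    and D_nonneg: "z \<in> Z \<Longrightarrow> 0 \<le> D z"
    and D_square_integrable: "integrable \<nu> (\<lambda>z. (D z)\<^sup>2)"
    and G_lipschitz:
      "\<theta> \<in> \<Theta> \<Longrightarrow> \<theta>' \<in> \<Theta> \<Longrightarrow> z \<in> Z \<Longrightarrow> norm (G \<theta> z - G \<theta>' z) \<le> D z * norm (\<theta> - \<theta>')"

definition push ::
  "(real^'d) set \<Rightarrow> (real^'m) measure \<Rightarrow> (real^'n \<Rightarrow> real^'m \<Rightarrow> real^'d)
    \<Rightarrow> real^'n \<Rightarrow> (real^'d) measure" where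
  "push \<Omega> \<nu> G \<theta> = distr \<nu> (restrict_space borel \<Omega>) (G \<theta>)"

text \<open>
  The transpose makes \<open>Jac\<close> the matrix with rows indexed by the parameters: its \<open>(i,j)\<close> entry is
  the derivative of the \<open>j\<close>-th component of \<open>G\<close> with respect to \<open>\<theta>\<^sub>i\<close>.
\<close>

definition Jac ::
  "(real^'n) set \<Rightarrow> (real^'n \<Rightarrow> real^'m \<Rightarrow> real^'d) \<Rightarrow> real^'n \<Rightarrow> real^'m \<Rightarrow> real^'d^'n" where
  "Jac \<Theta> G \<theta> z = transpose (jacobian (\<lambda>\<theta>'. G \<theta>' z) (at \<theta> within \<Theta>))"

definition Lop ::
  "('h \<Rightarrow> real^'d \<Rightarrow> real) \<Rightarrow> (real^'m) measure \<Rightarrow> (real^'n) set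
    \<Rightarrow> (real^'n \<Rightarrow> real^'m \<Rightarrow> real^'d) \<Rightarrow> real^'n \<Rightarrow> 'h \<Rightarrow> real^'n" where
  "Lop ev \<nu> \<Theta> G \<theta> f = (\<integral>z. Jac \<Theta> G \<theta> z *v grad (ev f) (at (G \<theta> z)) \<partial>\<nu>)"

text \<open>
  The integral of elements of the function space defining \<open>Ladj\<close> is, like the one in
  \<open>mean_embedding\<close>, the element whose value at each point is the integral of the values there.
  Both elements exist in the setting above, because the integrands are weakly integrable.
\<close>

definition Ladj ::
  "(real^'d) set \<Rightarrow> ('h::real_normed_vector \<Rightarrow> real^'d \<Rightarrow> real) \<Rightarrow> (real^'d \<Rightarrow> real^'d \<Rightarrow> real)
    \<Rightarrow> (real^'m) measure \<Rightarrow> (real^'n) set \<Rightarrow> (real^'n \<Rightarrow> real^'m \<Rightarrow> real^'d)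
    \<Rightarrow> real^'n \<Rightarrow> real^'n \<Rightarrow> 'h" where
  "Ladj \<Omega> ev k \<nu> \<Theta> G \<theta> v =
     elem_of \<Omega> ev (\<lambda>x. \<integral>z. ev (\<Sum>j\<in>UNIV. (transpose (Jac \<Theta> G \<theta> z) *v v) $ j
                                         *\<^sub>R (kgrad \<Omega> ev k (G \<theta> z) $ j)) x \<partial>\<nu>)"

definition Dop ::
  "(real^'d) set \<Rightarrow> ('h::real_normed_vector \<Rightarrow> real^'d \<Rightarrow> real) \<Rightarrow> (real^'d \<Rightarrow> real^'d \<Rightarrow> real)
    \<Rightarrow> (real^'m) measure \<Rightarrow> (real^'n) set \<Rightarrow> (real^'n \<Rightarrow> real^'m \<Rightarrow> real^'d)
    \<Rightarrow> real^'n \<Rightarrow> 'h \<Rightarrow> 'h" where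
  "Dop \<Omega> ev k \<nu> \<Theta> G \<theta> f = Ladj \<Omega> ev k \<nu> \<Theta> G \<theta> (Lop ev \<nu> \<Theta> G \<theta> f)"

definition witness ::
  "(real^'d) set \<Rightarrow> ('h::real_normed_vector \<Rightarrow> real^'d \<Rightarrow> real) \<Rightarrow> (real^'d \<Rightarrow> real^'d \<Rightarrow> real)
    \<Rightarrow> (real^'m) measure \<Rightarrow> (real^'n) set \<Rightarrow> (real^'n \<Rightarrow> real^'m \<Rightarrow> real^'d)
    \<Rightarrow> real \<Rightarrow> real \<Rightarrow> (real^'d) measure \<Rightarrow> real^'n \<Rightarrow> 'h" where
  "witness \<Omega> ev k \<nu> \<Theta> G \<alpha> \<beta> p \<theta> =
     (THE f. \<alpha> *\<^sub>R Dop \<Omega> ev k \<nu> \<Theta> G \<theta> f + \<beta> *\<^sub>R f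
           = mean_embedding \<Omega> ev k p - mean_embedding \<Omega> ev k (push \<Omega> \<nu> G \<theta>))"

definition Eset ::
  "(real^'d) set \<Rightarrow> ('h::real_normed_vector \<Rightarrow> real^'d \<Rightarrow> real)
    \<Rightarrow> (real^'m) measure \<Rightarrow> (real^'n) set \<Rightarrow> (real^'n \<Rightarrow> real^'m \<Rightarrow> real^'d)
    \<Rightarrow> real \<Rightarrow> real \<Rightarrow> real^'n \<Rightarrow> 'h set" where
  "Eset \<Omega> ev \<nu> \<Theta> G \<alpha> \<beta> \<theta> =
     {f. \<alpha> * (norm (grad (\<lambda>\<theta>'. \<integral>x. ev f x \<partial>(push \<Omega> \<nu> G \<theta>')) (at \<theta> within \<Theta>)))\<^sup>2
         + \<beta> * (norm f)\<^sup>2 \<le> 1/2}"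

definition mmd_reg ::
  "(real^'d) set \<Rightarrow> ('h::real_normed_vector \<Rightarrow> real^'d \<Rightarrow> real)
    \<Rightarrow> (real^'m) measure \<Rightarrow> (real^'n) set \<Rightarrow> (real^'n \<Rightarrow> real^'m \<Rightarrow> real^'d)
    \<Rightarrow> real \<Rightarrow> real \<Rightarrow> (real^'d) measure \<Rightarrow> real^'n \<Rightarrow> real" where
  "mmd_reg \<Omega> ev \<nu> \<Theta> G \<alpha> \<beta> p \<theta> =
     (SUP f\<in>Eset \<Omega> ev \<nu> \<Theta> G \<alpha> \<beta> \<theta>.
        (\<integral>x. ev f x \<partial>p) - (\<integral>x. ev f x \<partial>(push \<Omega> \<nu> G \<theta>)))"

end

theory Submission
  imports Defs
begin

text \<open>
  Write \<open>m = \<mu>\<^sub>p - \<mu>\<^sub>q\<close>, \<open>L = L\<^sub>\<theta>\<close> and \<open>D = L\<^sup>T L\<close>. Dominated convergence shows that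
  \<open>\<theta> \<mapsto> \<integral> f dq\<^sub>\<theta>\<close> has gradient \<open>L f\<close> for each fixed \<open>f\<close>. The polarisation
  \<open>1/2 \<parallel>m - \<delta>\<parallel>\<^sup>2 = 1/2 \<parallel>m\<parallel>\<^sup>2 - \<langle>m,\<delta>\<rangle> + 1/2 \<parallel>\<delta>\<parallel>\<^sup>2\<close>, where the increment \<open>\<delta>\<close> of the mean embedding
  is Lipschitz in \<open>\<theta>\<close>, reduces the derivative of \<open>F\<close> to this scalar fact: the gradient of \<open>F\<close>
  is \<open>- L m\<close>. No Bochner integral in the possibly nonseparable function space is needed.
  Along the flow, with \<open>\<alpha> D f + \<beta> f = m\<close>,
  \<open>F' = - \<langle>L m, L f\<rangle> = - \<alpha> \<parallel>D f\<parallel>\<^sup>2 - \<beta> \<parallel>L f\<parallel>\<^sup>2\<close>, and the squared regularized discrepancy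
  is \<open>1/2 \<langle>f, m\<rangle>\<close>.
\<close>

section \<open>Riesz representation and difference quotients within a set\<close>

text \<open>The representing vector minimises the quadratic functional \<open>J\<close>. The
  parallelogram law makes a minimising sequence Cauchy, completeness gives the minimiser
  \<open>u\<close>, and the first variation of \<open>J\<close> at \<open>u\<close> must vanish in
  every direction \<open>g\<close>.\<close>

lemma riesz_representation:
  fixes l :: "'a::{real_inner,complete_space} \<Rightarrow> real"
  assumes "bounded_linear l"
  obtains u where "\<And>f. l f = inner f u"
proof -
  interpret l: bounded_linear l by fact
  define J where "J x = (norm x)\<^sup>2 - 2 * l x" for x
  obtain K where K: "\<And>x. norm (l x) \<le> norm x * K" using l.bounded by blast
  have J_ge: "J x \<ge> - (K\<^sup>2)" for x
  proof -
    have "J x \<ge> (norm x)\<^sup>2 - 2 * (norm x * K)"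
      using K[of x] by (simp add: J_def)
    also have "(norm x)\<^sup>2 - 2 * (norm x * K) = (norm x - K)\<^sup>2 - K\<^sup>2"
      by (simp add: power2_diff)
    finally show ?thesis by (smt (verit) zero_le_power2)
  qed
  define i where "i = Inf (range J)"
  have bdd: "bdd_below (range J)" using J_ge by (auto intro!: bdd_belowI)
  have i_le: "i \<le> J x" for x unfolding i_def by (rule cInf_lower[OF _ bdd]) auto
  have "\<exists>x. J x < i + inverse (real (Suc n))" for n
    using cInf_lessD[of "range J" "i + inverse (real (Suc n))"] by (auto simp: i_def)
  then obtain X where X: "\<And>n. J (X n) < i + inverse (real (Suc n))" by metis
  \<comment> \<open>This is the parallelogram law: the linear parts cancel against that of the
    midpoint \<open>w\<close>, and \<open>J w\<close> is at least the infimum.\<close>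
  have par: "(norm (x - y))\<^sup>2 \<le> 2 * (J x - i) + 2 * (J y - i)" for x y
  proof -
    define w where "w = (1/2) *\<^sub>R (x + y)"
    have "(norm (x - y))\<^sup>2 = 2 * J x + 2 * J y - 4 * J w"
      by (simp add: w_def J_def l.add l.scaleR power_mult_distrib power2_norm_eq_inner inner_add
          inner_diff inner_commute field_simps)
    then show ?thesis using i_le[of w] by argo
  qed
  have "Cauchy X"
  proof (rule CauchyI)
    fix e :: real assume "e > 0"
    then obtain N where N: "inverse (real (Suc N)) < e\<^sup>2 / 4"
      using reals_Archimedean[of "e\<^sup>2/4"] by auto
    have "norm (X m - X n) < e" if "m \<ge> N" "n \<ge> N" for m n
    proof -
      have "inverse (real (Suc m)) \<le> inverse (real (Suc N))"
        "inverse (real (Suc n)) \<le> inverse (real (Suc N))" using that by (simp_all add: field_simps)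
      then have "(norm (X m - X n))\<^sup>2 < e\<^sup>2"
        using par[of "X m" "X n"] X[of m] X[of n] N by argo
      then show ?thesis using \<open>e > 0\<close> by (simp add: power_less_imp_less_base)
    qed
    then show "\<exists>M. \<forall>m\<ge>M. \<forall>n\<ge>M. norm (X m - X n) < e" by blast
  qed
  then obtain u where u: "X \<longlonglongrightarrow> u"
    by (metis Cauchy_convergent_iff convergent_def)
  have "(\<lambda>n. J (X n)) \<longlonglongrightarrow> J u"
    unfolding J_def by (intro tendsto_intros u l.tendsto)
  moreover have "(\<lambda>n. i + inverse (real (Suc n))) \<longlonglongrightarrow> i"
    using tendsto_add[OF tendsto_const[of i] LIMSEQ_inverse_real_of_nat] by simp
  ultimately have "J u \<le> i"
    using X by (intro LIMSEQ_le) (auto intro: less_imp_le)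
  then have min: "J u \<le> J x" for x using i_le[of x] by linarith
  have "l g = inner g u" for g
  proof -
    define c where "c = inner g u - l g"
    have eq: "J (u + s *\<^sub>R g) = J u + s\<^sup>2 * (norm g)\<^sup>2 + 2 * s * c" for s
      unfolding J_def c_def l.add l.scaleR power2_norm_eq_inner
      by (simp add: inner_add inner_commute power2_eq_square algebra_simps)
    have q: "0 \<le> s\<^sup>2 * (norm g)\<^sup>2 + 2 * s * c" for s
      using min[of "u + s *\<^sub>R g"] eq[of s] by linarith
    have "c = 0"
    proof (cases "g = 0")
      case True then show ?thesis by (simp add: c_def l.zero)
    next
      case False
      \<comment> \<open>The value of \<open>s\<close> inserted into \<open>q\<close> is the
        minimiser of that quadratic.\<close>
      then have "0 \<le> - (c\<^sup>2 / (norm g)\<^sup>2)"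
        using q[of "- c / (norm g)\<^sup>2"] by (simp add: power2_eq_square field_simps)
      then have "c\<^sup>2 / (norm g)\<^sup>2 \<le> 0" by linarith
      with False show ?thesis by (simp add: divide_le_0_iff)
    qed
    then show ?thesis by (simp add: c_def)
  qed
  then show ?thesis by (rule that)
qed

lemma has_derivative_difference_quotient:
  fixes f :: "'a::real_normed_vector \<Rightarrow> real"
  assumes "(f has_derivative f') (at x within S)"
    and "\<And>n. s n \<noteq> 0" "\<And>n. x + s n *\<^sub>R v \<in> S" "x \<in> S" and "s \<longlonglongrightarrow> 0"
  shows "(\<lambda>n. (f (x + s n *\<^sub>R v) - f x) / s n) \<longlonglongrightarrow> f' v"
proof -
  define R where "R = {r. x + r *\<^sub>R v \<in> S}"
  interpret f': bounded_linear f' using assms(1) by (rule has_derivative_bounded_linear)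
  have "((\<lambda>r. x + r *\<^sub>R v) has_derivative (\<lambda>r. r *\<^sub>R v)) (at 0 within R)"
    by (auto intro!: derivative_eq_intros)
  moreover have "(f has_derivative f') (at (x + 0 *\<^sub>R v) within (\<lambda>r. x + r *\<^sub>R v) ` R)"
    by (rule has_derivative_subset[of _ _ _ S]) (use assms in \<open>auto simp: R_def\<close>)
  ultimately have "((\<lambda>r. f (x + r *\<^sub>R v)) has_derivative (\<lambda>r. f' (r *\<^sub>R v))) (at 0 within R)"
    by (rule has_derivative_in_compose)
  then have "((\<lambda>r. f (x + r *\<^sub>R v)) has_field_derivative f' v) (at 0 within R)"
    by (simp add: f'.scaleR has_field_derivative_def mult.commute[of _ "f' v"])
  then have "((\<lambda>r. (f (x + r *\<^sub>R v) - f x) / r) \<longlongrightarrow> f' v) (at 0 within R)"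
    by (simp add: has_field_derivative_iff)
  then show ?thesis
    unfolding tendsto_at_iff_sequentially using assms by (auto simp: R_def o_def)
qed

lemma matrix_vector_mult_inner:
  fixes A :: "real^'a^'b"
  shows "inner (A *v x) y = inner x (transpose A *v y)"
  by (metis dot_lmul_matrix inner_commute transpose_matrix_vector)

section \<open>Function values and elements given by bounded functionals\<close>

context rkhs
begin

lemma elem_of_eqI: "(\<And>x. x \<in> \<Omega> \<Longrightarrow> ev h x = \<phi> x) \<Longrightarrow> elem_of \<Omega> ev \<phi> = h"
  unfolding elem_of_def by (rule the_equality) (auto intro: ev_inject)

lemma
  assumes "x \<in> \<Omega>"
  shows ev_eq_inner: "ev f x = inner f (ksec \<Omega> ev k x)"
    and ev_ksec: "y \<in> \<Omega> \<Longrightarrow> ev (ksec \<Omega> ev k x) y = k x y"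
proof -
  obtain h where h: "\<forall>y\<in>\<Omega>. ev h y = k x y" "\<forall>f. ev f x = inner f h"
    using kernel[OF assms] by blast
  have "ksec \<Omega> ev k x = h" unfolding ksec_def by (rule elem_of_eqI) (use h in auto)
  with h show "ev f x = inner f (ksec \<Omega> ev k x)"
    and "y \<in> \<Omega> \<Longrightarrow> ev (ksec \<Omega> ev k x) y = k x y" by auto
qed

text \<open>The Riesz vector of \<open>l\<close> takes the value \<open>l (k(x,.))\<close> at
  \<open>x\<close> by the reproducing property, so injectivity of evaluation identifies it with
  \<open>elem_of\<close>. Existence comes with it; mean embeddings and the adjoint of
  \<open>L\<close> are both obtained this way from scalar integrals.\<close>

lemma inner_elem_of:
  assumes "bounded_linear l" and "\<And>x. x \<in> \<Omega> \<Longrightarrow> \<phi> x = l (ksec \<Omega> ev k x)"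
  shows "inner f (elem_of \<Omega> ev \<phi>) = l f"
proof -
  obtain u where u: "\<And>f. l f = inner f u" using riesz_representation[OF assms(1)] by blast
  have "elem_of \<Omega> ev \<phi> = u"
    by (rule elem_of_eqI) (simp add: assms(2) u ev_eq_inner inner_commute)
  then show ?thesis by (simp add: u)
qed

end

section \<open>Bounded evaluation, integrability and mean embeddings\<close>

context generator_setting
begin

abbreviation \<kappa> :: "real^'d \<Rightarrow> 'h" where "\<kappa> \<equiv> ksec \<Omega> ev k"

lemma ev_linear:
  assumes "x \<in> \<Omega>"
  shows "ev (f + g) x = ev f x + ev g x" "ev (c *\<^sub>R f) x = c * ev f x"
  by (simp_all add: ev_eq_inner assms inner_add)

lemma space_\<nu>: "space \<nu> = Z"
  using sets_eq_imp_space_eq[OF sets_\<nu>] by (simp add: space_restrict_space)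

lemma G_in: "\<theta> \<in> \<Theta> \<Longrightarrow> z \<in> Z \<Longrightarrow> G \<theta> z \<in> \<Omega>"
  using measurable_space[OF G_measurable] by (simp add: space_\<nu> space_restrict_space)

lemma ev_measurable: "ev f \<in> borel_measurable (restrict_space borel \<Omega>)"
proof -
  have "continuous_on \<Omega> \<kappa>"
    using kernel_differentiable
    by (metis continuous_at_imp_continuous_on differentiable_imp_continuous_within)
  then have "continuous_on \<Omega> (\<lambda>x. inner f (\<kappa> x))" by (intro continuous_intros)
  then have "continuous_on \<Omega> (ev f)" by (simp add: ev_eq_inner cong: continuous_on_cong)
  then show ?thesis by (rule borel_measurable_continuous_on_restrict)
qed

text \<open>The reproducing property gives \<open>k(x,.)\<close> the squared norm
  \<open>k x x\<close>, so a bounded kernel bounds all point evaluations by one constant.\<close>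

lemma ev_bounded: obtains C where "\<And>f x. x \<in> \<Omega> \<Longrightarrow> \<bar>ev f x\<bar> \<le> norm f * C"
proof -
  obtain C where C: "\<And>x y. x \<in> \<Omega> \<Longrightarrow> y \<in> \<Omega> \<Longrightarrow> \<bar>k x y\<bar> \<le> C" using bounded_kernel by blast
  have "\<bar>ev f x\<bar> \<le> norm f * sqrt C" if "x \<in> \<Omega>" for f x
  proof -
    have "(norm (\<kappa> x))\<^sup>2 = k x x"
      using ev_eq_inner[OF that, of "\<kappa> x"] ev_ksec[OF that that] by (simp add: power2_norm_eq_inner)
    then have "norm (\<kappa> x) \<le> sqrt C" using C[OF that that] by (intro real_le_rsqrt) auto
    then show ?thesis
      using Cauchy_Schwarz_ineq2[of f "\<kappa> x"] that
      by (simp add: ev_eq_inner) (meson mult_left_mono norm_ge_zero order_trans)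
  qed
  then show ?thesis by (rule that)
qed

lemma ev_integrable:
  assumes "prob_space \<rho>" and "sets \<rho> = sets (restrict_space borel \<Omega>)"
  shows "integrable \<rho> (ev f)"
proof -
  interpret prob_space \<rho> by fact
  have sp: "space \<rho> = \<Omega>" using sets_eq_imp_space_eq[OF assms(2)] by (simp add: space_restrict_space)
  obtain C where C: "\<And>f x. x \<in> \<Omega> \<Longrightarrow> \<bar>ev f x\<bar> \<le> norm f * C" by (rule ev_bounded) blast
  show ?thesis
  proof (rule integrable_const_bound)
    show "AE x in \<rho>. norm (ev f x) \<le> norm f * C" by (rule AE_I2) (auto simp: sp C)
    show "ev f \<in> borel_measurable \<rho>"
      using ev_measurable measurable_cong_sets[OF assms(2) refl] by blast
  qed
qed

text \<open>Integration against \<open>\<rho>\<close> is a bounded functional by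
  \<open>ev_bounded\<close>, and its values on the sections \<open>k(x,.)\<close> are those that
  define the mean embedding.\<close>

lemma inner_mean_embedding:
  assumes "prob_space \<rho>" and "sets \<rho> = sets (restrict_space borel \<Omega>)"
  shows "inner f (mean_embedding \<Omega> ev k \<rho>) = (\<integral>x. ev f x \<partial>\<rho>)"
  unfolding mean_embedding_def
proof (rule inner_elem_of)
  interpret prob_space \<rho> by fact
  have sp: "space \<rho> = \<Omega>" using sets_eq_imp_space_eq[OF assms(2)] by (simp add: space_restrict_space)
  note int = ev_integrable[OF assms]
  obtain C where C: "\<And>f x. x \<in> \<Omega> \<Longrightarrow> \<bar>ev f x\<bar> \<le> norm f * C" by (rule ev_bounded) blast
  show "bounded_linear (\<lambda>f. \<integral>x. ev f x \<partial>\<rho>)"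
  proof (rule bounded_linear_intro)
    fix f g and c :: real
    have "(\<integral>x. ev (f + g) x \<partial>\<rho>) = (\<integral>x. ev f x + ev g x \<partial>\<rho>)"
      by (rule Bochner_Integration.integral_cong) (auto simp: sp ev_linear)
    then show "(\<integral>x. ev (f + g) x \<partial>\<rho>) = (\<integral>x. ev f x \<partial>\<rho>) + (\<integral>x. ev g x \<partial>\<rho>)"
      by (simp add: int)
    have "(\<integral>x. ev (c *\<^sub>R f) x \<partial>\<rho>) = (\<integral>x. c * ev f x \<partial>\<rho>)"
      by (rule Bochner_Integration.integral_cong) (auto simp: sp ev_linear)
    then show "(\<integral>x. ev (c *\<^sub>R f) x \<partial>\<rho>) = c *\<^sub>R (\<integral>x. ev f x \<partial>\<rho>)" by simp
    have "norm (\<integral>x. ev f x \<partial>\<rho>) \<le> (\<integral>x. norm f * C \<partial>\<rho>)"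
      by (rule Bochner_Integration.integral_norm_bound_integral) (auto simp: sp C int)
    then show "norm (\<integral>x. ev f x \<partial>\<rho>) \<le> norm f * C" by (simp add: prob_space)
  qed
  show "(\<integral>y. k x y \<partial>\<rho>) = (\<integral>y. ev (\<kappa> x) y \<partial>\<rho>)" if "x \<in> \<Omega>" for x
    by (rule Bochner_Integration.integral_cong) (auto simp: sp ev_ksec that)
qed

lemma
  assumes "\<theta> \<in> \<Theta>"
  shows prob_push: "prob_space (push \<Omega> \<nu> G \<theta>)"
    and sets_push: "sets (push \<Omega> \<nu> G \<theta>) = sets (restrict_space borel \<Omega>)"
    and integral_push: "(\<integral>x. ev f x \<partial>push \<Omega> \<nu> G \<theta>) = (\<integral>z. ev f (G \<theta> z) \<partial>\<nu>)"
    and ev_G_measurable: "(\<lambda>z. ev f (G \<theta> z)) \<in> borel_measurable \<nu>"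
    and ev_G_integrable: "integrable \<nu> (\<lambda>z. ev f (G \<theta> z))"
proof -
  interpret prob_space \<nu> by (rule prob_\<nu>)
  note G = G_measurable[OF assms]
  show p: "prob_space (push \<Omega> \<nu> G \<theta>)" unfolding push_def by (rule prob_space_distr) (rule G)
  show s: "sets (push \<Omega> \<nu> G \<theta>) = sets (restrict_space borel \<Omega>)" by (simp add: push_def)
  show "(\<integral>x. ev f x \<partial>push \<Omega> \<nu> G \<theta>) = (\<integral>z. ev f (G \<theta> z) \<partial>\<nu>)"
    unfolding push_def by (rule integral_distr[OF G ev_measurable])
  show "(\<lambda>z. ev f (G \<theta> z)) \<in> borel_measurable \<nu>"
    by (rule measurable_compose[OF G ev_measurable])
  show "integrable \<nu> (\<lambda>z. ev f (G \<theta> z))"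
    using ev_integrable[OF p s, of f] unfolding push_def integrable_distr_eq[OF G ev_measurable] .
qed

section \<open>Gradients in the point and in the parameter\<close>

text \<open>Uniqueness of a derivative within a set needs arbitrarily small steps along each
  coordinate axis that stay in the set, which is what \<open>parameter_directions\<close>
  supplies.\<close>

lemma gradient_within_unique:
  assumes "\<theta> \<in> \<Theta>" and "(\<phi> has_derivative (\<lambda>h. inner g h)) (at \<theta> within \<Theta>)"
  shows "grad \<phi> (at \<theta> within \<Theta>) = g"
  unfolding grad_def
proof (rule the_equality)
  fix g' assume g': "(\<phi> has_derivative (\<lambda>h. inner g' h)) (at \<theta> within \<Theta>)"
  have "(\<lambda>h. inner g' h) = (\<lambda>h. inner g h)"
    by (rule frechet_derivative_unique_within[OF g' assms(2)])
      (use parameter_directions[OF assms(1)] in \<open>auto simp: Basis_vec_def\<close>)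
  then have "inner g' h = inner g h" for h by meson
  then have "inner (g' - g) (g' - g) = 0" by (simp add: inner_diff_left)
  then show "g' = g" by simp
qed (fact assms(2))

text \<open>On \<open>\<Omega>\<close> the value of \<open>f\<close> is its inner product with
  \<open>k(x,.)\<close>, so the derivative passes to the kernel section. Openness of
  \<open>\<Omega>\<close> transfers it to \<open>ev f\<close>, for which that formula is available
  only on \<open>\<Omega>\<close>.\<close>

lemma ev_has_derivative:
  assumes "x \<in> \<Omega>"
  shows "(ev f has_derivative (\<lambda>h. inner (grad (ev f) (at x)) h)) (at x)"
    and "grad (ev f) (at x) $ j = inner f (kgrad \<Omega> ev k x $ j)"
proof -
  define K where "K = frechet_derivative \<kappa> (at x)"
  define g where "g = (\<chi> j. inner f (kgrad \<Omega> ev k x $ j))"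
  have K: "(\<kappa> has_derivative K) (at x)"
    using kernel_differentiable[OF assms] unfolding K_def frechet_derivative_works[symmetric] .
  then interpret K: bounded_linear K by (rule has_derivative_bounded_linear)
  have Kg: "inner f (K h) = inner g h" for h
  proof -
    have "K h = K (\<Sum>j\<in>UNIV. (h $ j) *\<^sub>R axis j 1)" by (simp add: basis_expansion flip: scalar_mult_eq_scaleR)
    also have "\<dots> = (\<Sum>j\<in>UNIV. (h $ j) *\<^sub>R kgrad \<Omega> ev k x $ j)"
      by (simp add: K.sum K.scaleR kgrad_def flip: K_def)
    finally show ?thesis
      by (simp add: g_def inner_sum_right inner_vec_def[of g] mult.commute) (simp add: g_def inner_vec_def mult.commute)
  qed
  have "((\<lambda>y. inner f (\<kappa> y)) has_derivative (\<lambda>h. inner f (K h))) (at x)"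
    by (intro derivative_intros K)
  then have D: "(ev f has_derivative (\<lambda>h. inner g h)) (at x)"
    unfolding Kg by (rule has_derivative_transform_within_open[OF _ open_\<Omega> assms]) (simp add: ev_eq_inner)
  have "grad (ev f) (at x) = g"
    unfolding grad_def
  proof (rule the_equality)
    fix g' assume "(ev f has_derivative (\<lambda>h. inner g' h)) (at x)"
    then have "(\<lambda>h. inner g' h) = (\<lambda>h. inner g h)" using D by (rule has_derivative_unique)
    then have "inner g' h = inner g h" for h by meson
    then have "inner (g' - g) (g' - g) = 0" by (simp add: inner_diff_left)
    then show "g' = g" by simp
  qed (fact D)
  with D show "(ev f has_derivative (\<lambda>h. inner (grad (ev f) (at x)) h)) (at x)"
    and "grad (ev f) (at x) $ j = inner f (kgrad \<Omega> ev k x $ j)" by (auto simp: g_def)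
qed

text \<open>This is the integrand of \<open>Lop\<close>; by the chain rule it is the gradient in
  \<open>\<theta>\<close> of the value of \<open>f\<close> at \<open>G \<theta> z\<close>.\<close>

definition ev_G_gradient :: "'h \<Rightarrow> real^'n \<Rightarrow> real^'m \<Rightarrow> real^'n" where
  "ev_G_gradient f \<theta> z = Jac \<Theta> G \<theta> z *v grad (ev f) (at (G \<theta> z))"

lemma ev_G_has_derivative:
  assumes "\<theta> \<in> \<Theta>" "z \<in> Z"
  shows "((\<lambda>\<theta>'. ev f (G \<theta>' z)) has_derivative (\<lambda>h. inner (ev_G_gradient f \<theta> z) h)) (at \<theta> within \<Theta>)"
proof -
  have "((\<lambda>\<theta>'. G \<theta>' z) has_derivative (\<lambda>h. transpose (Jac \<Theta> G \<theta> z) *v h)) (at \<theta> within \<Theta>)"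
    using G_differentiable[OF assms] unfolding Jac_def transpose_transpose jacobian_works .
  from diff_chain_within[OF this has_derivative_at_withinI[OF ev_has_derivative(1)[OF G_in[OF assms]]]]
  show ?thesis
    by (simp add: o_def ev_G_gradient_def matrix_vector_mult_inner)
qed

text \<open>The source of every domination below: the Lipschitz constant in the parameter is
  integrable in \<open>z\<close> and depends on \<open>f\<close> only through its norm.\<close>

lemma ev_G_lipschitz:
  assumes "\<theta> \<in> \<Theta>" "\<theta>' \<in> \<Theta>" "z \<in> Z"
  shows "\<bar>ev f (G \<theta>' z) - ev f (G \<theta> z)\<bar> \<le> norm f * (Lip * D z) * norm (\<theta>' - \<theta>)"
proof -
  have "\<bar>ev f (G \<theta>' z) - ev f (G \<theta> z)\<bar> = \<bar>inner f (\<kappa> (G \<theta>' z) - \<kappa> (G \<theta> z))\<bar>"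
    by (simp add: ev_eq_inner G_in assms inner_diff_right)
  also have "\<dots> \<le> norm f * norm (\<kappa> (G \<theta>' z) - \<kappa> (G \<theta> z))" by (rule Cauchy_Schwarz_ineq2)
  also have "\<dots> \<le> norm f * (Lip * norm (G \<theta>' z - G \<theta> z))"
    by (intro mult_left_mono kernel_lipschitz G_in assms) auto
  also have "\<dots> \<le> norm f * (Lip * (D z * norm (\<theta>' - \<theta>)))"
    using Lip_pos by (intro mult_left_mono G_lipschitz assms) auto
  finally show ?thesis by (simp add: mult_ac)
qed

text \<open>Measurability of \<open>D\<close> is recovered from that of its square by taking the
  root, as \<open>D\<close> is nonnegative on \<open>Z\<close>; integrability follows from
  \<open>D \<le> 1 + D\<^sup>2\<close> on a probability space.\<close>

lemma D_integrable: "integrable \<nu> D"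
proof -
  interpret prob_space \<nu> by (rule prob_\<nu>)
  have "(\<lambda>z. sqrt ((D z)\<^sup>2)) \<in> borel_measurable \<nu>" using D_square_integrable by measurable
  then have m: "D \<in> borel_measurable \<nu>"
    by (rule measurable_cong[THEN iffD1, rotated]) (simp add: space_\<nu> D_nonneg)
  have "D z \<le> 1 + (D z)\<^sup>2" for z
    using zero_le_power2[of "D z - 1/2"] by (simp add: power2_eq_square algebra_simps)
  then show ?thesis
    by (intro Bochner_Integration.integrable_bound[OF _ m, of "\<lambda>z. 1 + (D z)\<^sup>2"])
      (auto simp: D_square_integrable D_nonneg space_\<nu>)
qed

text \<open>The same sequence of parameters serves all \<open>z\<close>, which yields measurability in \<open>z\<close>.\<close>

lemma partial_derivative_sequence:
  assumes "\<theta> \<in> \<Theta>"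
  obtains s where "\<And>n. s n \<noteq> 0" "\<And>n. \<theta> + s n *\<^sub>R axis i 1 \<in> \<Theta>"
    "\<And>f z. z \<in> Z \<Longrightarrow>
      (\<lambda>n. (ev f (G (\<theta> + s n *\<^sub>R axis i 1) z) - ev f (G \<theta> z)) / s n) \<longlonglongrightarrow> ev_G_gradient f \<theta> z $ i"
proof -
  have "\<exists>s. 0 < \<bar>s\<bar> \<and> \<bar>s\<bar> < inverse (real (Suc n)) \<and> \<theta> + s *\<^sub>R axis i 1 \<in> \<Theta>" for n
    by (rule parameter_directions[OF assms]) auto
  then obtain s where s: "\<And>n. 0 < \<bar>s n\<bar>" "\<And>n. \<bar>s n\<bar> < inverse (real (Suc n))"
    "\<And>n. \<theta> + s n *\<^sub>R axis i 1 \<in> \<Theta>" by metis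
  have "s \<longlonglongrightarrow> 0"
    by (rule Lim_null_comparison[OF _ LIMSEQ_inverse_real_of_nat], rule always_eventually)
      (simp only: real_norm_def less_imp_le[OF s(2)] simp_thms)
  show ?thesis
  proof (rule that)
    show "(\<lambda>n. (ev f (G (\<theta> + s n *\<^sub>R axis i 1) z) - ev f (G \<theta> z)) / s n) \<longlonglongrightarrow> ev_G_gradient f \<theta> z $ i"
      if "z \<in> Z" for f z
      using has_derivative_difference_quotient[OF ev_G_has_derivative[OF assms that, of f], of s "axis i 1"]
        s(1,3) assms \<open>s \<longlonglongrightarrow> 0\<close> by (simp add: inner_axis)
    show "s n \<noteq> 0" for n using s(1)[of n] by simp
  qed (fact s(3))
qed

text \<open>Each coordinate is a pointwise limit of measurable difference quotients.\<close>

lemma ev_G_gradient_measurable: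
  assumes "\<theta> \<in> \<Theta>"
  shows "ev_G_gradient f \<theta> \<in> borel_measurable \<nu>"
proof -
  have "(\<lambda>z. ev_G_gradient f \<theta> z $ i) \<in> borel_measurable \<nu>" for i
  proof -
    obtain s where s: "\<And>n. \<theta> + s n *\<^sub>R axis i 1 \<in> \<Theta>"
      "\<And>f z. z \<in> Z \<Longrightarrow>
        (\<lambda>n. (ev f (G (\<theta> + s n *\<^sub>R axis i 1) z) - ev f (G \<theta> z)) / s n) \<longlonglongrightarrow> ev_G_gradient f \<theta> z $ i"
      by (rule partial_derivative_sequence[OF assms]) blast
    show ?thesis
      by (rule borel_measurable_LIMSEQ_real[of _ "\<lambda>n z. (ev f (G (\<theta> + s n *\<^sub>R axis i 1) z) - ev f (G \<theta> z)) / s n"])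
        (auto simp: space_\<nu> s(2) intro!: ev_G_measurable s(1) assms borel_measurable_divide borel_measurable_diff)
  qed
  then have "(\<lambda>z. inner (ev_G_gradient f \<theta> z) b) \<in> borel_measurable \<nu>" if "b \<in> Basis" for b
    using that by (auto simp: Basis_vec_def inner_axis)
  then show ?thesis by (subst borel_measurable_euclidean_space) auto
qed

text \<open>Each partial derivative inherits the Lipschitz constant as a limit of difference
  quotients. The factor \<open>CARD('n)\<close> comes from estimating the Euclidean norm by the sum
  of the coordinates.\<close>

lemma ev_G_gradient_bound:
  assumes "\<theta> \<in> \<Theta>" "z \<in> Z"
  shows "norm (ev_G_gradient f \<theta> z) \<le> real CARD('n) * (norm f * (Lip * D z))"
proof -
  have "\<bar>ev_G_gradient f \<theta> z $ i\<bar> \<le> norm f * (Lip * D z)" for i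
  proof -
    obtain s where s: "\<And>n. s n \<noteq> 0" "\<And>n. \<theta> + s n *\<^sub>R axis i 1 \<in> \<Theta>"
      "(\<lambda>n. (ev f (G (\<theta> + s n *\<^sub>R axis i 1) z) - ev f (G \<theta> z)) / s n) \<longlonglongrightarrow> ev_G_gradient f \<theta> z $ i"
      by (rule partial_derivative_sequence[OF assms(1)]) (use assms(2) in blast)
    have "\<bar>(ev f (G (\<theta> + s n *\<^sub>R axis i 1) z) - ev f (G \<theta> z)) / s n\<bar> \<le> norm f * (Lip * D z)" for n
      using ev_G_lipschitz[OF assms(1) s(2)[of n] assms(2), of f] s(1)[of n]
      by (simp add: field_simps)
    then show ?thesis using tendsto_rabs[OF s(3)] by (intro LIMSEQ_le_const2) auto
  qed
  then have "(\<Sum>i\<in>UNIV. \<bar>ev_G_gradient f \<theta> z $ i\<bar>) \<le> (\<Sum>i\<in>(UNIV::'n set). norm f * (Lip * D z))"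
    by (intro sum_mono) auto
  then show ?thesis using norm_le_l1_cart[of "ev_G_gradient f \<theta> z"] by simp
qed

lemma ev_G_gradient_integrable:
  assumes "\<theta> \<in> \<Theta>"
  shows "integrable \<nu> (ev_G_gradient f \<theta>)"
  using ev_G_gradient_bound[OF assms] Lip_pos
  by (intro Bochner_Integration.integrable_bound[OF _ ev_G_gradient_measurable[OF assms],
        of "\<lambda>z. real CARD('n) * (norm f * (Lip * D z))"])
    (auto simp: D_integrable space_\<nu> D_nonneg)

section \<open>The operator L and its adjoint\<close>

lemma Lop_eq: "Lop ev \<nu> \<Theta> G \<theta> f = (\<integral>z. ev_G_gradient f \<theta> z \<partial>\<nu>)"
  by (simp add: Lop_def ev_G_gradient_def)

lemma ev_G_gradient_linear:
  assumes "\<theta> \<in> \<Theta>" "z \<in> Z"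
  shows "ev_G_gradient (f + g) \<theta> z = ev_G_gradient f \<theta> z + ev_G_gradient g \<theta> z"
    and "ev_G_gradient (c *\<^sub>R f) \<theta> z = c *\<^sub>R ev_G_gradient f \<theta> z"
proof -
  let ?g = "\<lambda>f. grad (ev f) (at (G \<theta> z))"
  have "?g (f + g) = ?g f + ?g g" "?g (c *\<^sub>R f) = c *\<^sub>R ?g f"
    by (simp_all add: vec_eq_iff ev_has_derivative(2)[OF G_in[OF assms]] inner_add)
  then show "ev_G_gradient (f + g) \<theta> z = ev_G_gradient f \<theta> z + ev_G_gradient g \<theta> z"
    and "ev_G_gradient (c *\<^sub>R f) \<theta> z = c *\<^sub>R ev_G_gradient f \<theta> z"
    by (simp_all add: ev_G_gradient_def matrix_vector_right_distrib matrix_vector_mult_scaleR)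
qed

lemma Lop_bounded_linear:
  assumes "\<theta> \<in> \<Theta>"
  shows "bounded_linear (Lop ev \<nu> \<Theta> G \<theta>)"
proof (rule bounded_linear_intro)
  note int = ev_G_gradient_integrable[OF assms]
  fix f g and c :: real
  have "(\<integral>z. ev_G_gradient (f + g) \<theta> z \<partial>\<nu>) = (\<integral>z. ev_G_gradient f \<theta> z + ev_G_gradient g \<theta> z \<partial>\<nu>)"
    by (rule Bochner_Integration.integral_cong) (auto simp: space_\<nu> ev_G_gradient_linear assms)
  then show "Lop ev \<nu> \<Theta> G \<theta> (f + g) = Lop ev \<nu> \<Theta> G \<theta> f + Lop ev \<nu> \<Theta> G \<theta> g"
    by (simp add: Lop_eq int)
  have "(\<integral>z. ev_G_gradient (c *\<^sub>R f) \<theta> z \<partial>\<nu>) = (\<integral>z. c *\<^sub>R ev_G_gradient f \<theta> z \<partial>\<nu>)"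
    by (rule Bochner_Integration.integral_cong) (auto simp: space_\<nu> ev_G_gradient_linear assms)
  then show "Lop ev \<nu> \<Theta> G \<theta> (c *\<^sub>R f) = c *\<^sub>R Lop ev \<nu> \<Theta> G \<theta> f"
    by (simp add: Lop_eq)
  have "norm (\<integral>z. ev_G_gradient f \<theta> z \<partial>\<nu>) \<le> (\<integral>z. real CARD('n) * (norm f * (Lip * D z)) \<partial>\<nu>)"
    using ev_G_gradient_bound[OF assms] int
    by (intro Bochner_Integration.integral_norm_bound_integral) (auto simp: space_\<nu> D_integrable)
  then show "norm (Lop ev \<nu> \<Theta> G \<theta> f) \<le> norm f * (real CARD('n) * (Lip * (\<integral>z. D z \<partial>\<nu>)))"
    by (simp add: Lop_eq mult_ac)
qed

text \<open>At a point \<open>x\<close> the integrand of \<open>Ladj\<close> equals the integrand of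
  \<open>L (k(x,.))\<close> paired with \<open>v\<close>. The values defining \<open>Ladj\<close>
  are thus those of the bounded functional \<open>f \<mapsto> \<langle>L f, v\<rangle>\<close>, and
  \<open>inner_elem_of\<close> applies.\<close>

lemma inner_Ladj:
  assumes "\<theta> \<in> \<Theta>"
  shows "inner f (Ladj \<Omega> ev k \<nu> \<Theta> G \<theta> v) = inner (Lop ev \<nu> \<Theta> G \<theta> f) v"
  unfolding Ladj_def
proof (rule inner_elem_of)
  show "bounded_linear (\<lambda>f. inner (Lop ev \<nu> \<Theta> G \<theta> f) v)"
    using bounded_linear_compose[OF bounded_linear_inner_left Lop_bounded_linear[OF assms]] .
  fix x assume x: "x \<in> \<Omega>"
  have "ev (\<Sum>j\<in>UNIV. (transpose (Jac \<Theta> G \<theta> z) *v v) $ j *\<^sub>R (kgrad \<Omega> ev k (G \<theta> z) $ j)) x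
      = inner (ev_G_gradient (\<kappa> x) \<theta> z) v" if "z \<in> Z" for z
  proof -
    have "inner (ev_G_gradient (\<kappa> x) \<theta> z) v
        = (\<Sum>j\<in>UNIV. inner (\<kappa> x) (kgrad \<Omega> ev k (G \<theta> z) $ j) * (transpose (Jac \<Theta> G \<theta> z) *v v) $ j)"
      unfolding ev_G_gradient_def matrix_vector_mult_inner inner_vec_def[of "grad _ _"]
      by (simp add: ev_has_derivative(2)[OF G_in[OF assms that]])
    then show ?thesis
      by (simp add: ev_eq_inner[OF x] inner_sum_right inner_commute mult.commute)
  qed
  then have "(\<integral>z. ev (\<Sum>j\<in>UNIV. (transpose (Jac \<Theta> G \<theta> z) *v v) $ j
        *\<^sub>R (kgrad \<Omega> ev k (G \<theta> z) $ j)) x \<partial>\<nu>) = (\<integral>z. inner (ev_G_gradient (\<kappa> x) \<theta> z) v \<partial>\<nu>)"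
    by (intro Bochner_Integration.integral_cong) (auto simp: space_\<nu>)
  then show "(\<integral>z. ev (\<Sum>j\<in>UNIV. (transpose (Jac \<Theta> G \<theta> z) *v v) $ j
        *\<^sub>R (kgrad \<Omega> ev k (G \<theta> z) $ j)) x \<partial>\<nu>) = inner (Lop ev \<nu> \<Theta> G \<theta> (\<kappa> x)) v"
    by (simp add: Lop_eq ev_G_gradient_integrable[OF assms])
qed

section \<open>Differentiation under the integral and the gradient of the discrepancy\<close>

text \<open>The normalised first-order remainder \<open>r\<close> tends to 0 for each
  \<open>z\<close> and is dominated by the integrable \<open>b\<close>, so its integral tends to 0
  as well.\<close>

lemma integral_push_has_derivative:
  assumes "\<theta> \<in> \<Theta>"
  shows "((\<lambda>\<theta>'. \<integral>x. ev f x \<partial>push \<Omega> \<nu> G \<theta>')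
    has_derivative (\<lambda>h. inner (Lop ev \<nu> \<Theta> G \<theta> f) h)) (at \<theta> within \<Theta>)"
proof (rule has_derivativeI)
  show "bounded_linear (\<lambda>h. inner (Lop ev \<nu> \<Theta> G \<theta> f) h)" by (rule bounded_linear_inner_right)
  define r where "r \<eta> z = ((ev f (G \<eta> z) - ev f (G \<theta> z)) - inner (ev_G_gradient f \<theta> z) (\<eta> - \<theta>)) /\<^sub>R norm (\<eta> - \<theta>)"
    for \<eta> z
  \<comment> \<open>The summand 1 covers the increment, by \<open>ev_G_lipschitz\<close>; the
    summand \<open>CARD('n)\<close> covers the linear term, by
    \<open>ev_G_gradient_bound\<close>.\<close>
  define b where "b z = (1 + real CARD('n)) * (norm f * (Lip * D z))" for z
  have r_integrable: "integrable \<nu> (r \<eta>)" if "\<eta> \<in> \<Theta>" for \<eta>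
    unfolding r_def by (intro integrable_scaleR_right Bochner_Integration.integrable_diff ev_G_integrable
        integrable_inner_left ev_G_gradient_integrable assms that)
  have r_lim: "((\<lambda>\<eta>. r \<eta> z) \<longlongrightarrow> 0) (at \<theta> within \<Theta>)" if "z \<in> Z" for z
    using ev_G_has_derivative[OF assms that, of f] unfolding has_derivative_at_within r_def by blast
  have r_bound: "norm (r \<eta> z) \<le> b z" if "\<eta> \<in> \<Theta>" "z \<in> Z" for \<eta> z
  proof (cases "\<eta> = \<theta>")
    case False
    have "\<bar>inner (ev_G_gradient f \<theta> z) (\<eta> - \<theta>)\<bar>
        \<le> real CARD('n) * (norm f * (Lip * D z)) * norm (\<eta> - \<theta>)"
      using Cauchy_Schwarz_ineq2[of "ev_G_gradient f \<theta> z" "\<eta> - \<theta>"]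
        mult_right_mono[OF ev_G_gradient_bound[OF assms that(2), of f] norm_ge_zero[of "\<eta> - \<theta>"]] by linarith
    with ev_G_lipschitz[OF assms that, of f]
    have "\<bar>ev f (G \<eta> z) - ev f (G \<theta> z) - inner (ev_G_gradient f \<theta> z) (\<eta> - \<theta>)\<bar>
        \<le> norm f * (Lip * D z) * norm (\<eta> - \<theta>)
          + real CARD('n) * (norm f * (Lip * D z)) * norm (\<eta> - \<theta>)"
      by linarith
    also have "\<dots> = b z * norm (\<eta> - \<theta>)" by (simp add: b_def algebra_simps)
    finally show ?thesis using False by (simp add: r_def divide_simps abs_mult)
  qed (use Lip_pos D_nonneg that in \<open>simp add: r_def b_def\<close>)
  \<comment> \<open>The dominated convergence theorem speaks of sequences, so the limit within
    \<open>\<Theta>\<close> is tested along sequences.\<close>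
  have "((\<lambda>\<eta>. \<integral>z. r \<eta> z \<partial>\<nu>) \<longlongrightarrow> 0) (at \<theta> within \<Theta>)"
    unfolding tendsto_at_iff_sequentially o_def
  proof (intro allI impI)
    fix X assume X: "\<forall>i. X i \<in> \<Theta> - {\<theta>}" "X \<longlonglongrightarrow> \<theta>"
    have "(\<lambda>n. \<integral>z. r (X n) z \<partial>\<nu>) \<longlonglongrightarrow> (\<integral>z. 0 \<partial>\<nu>)"
    proof (rule integral_dominated_convergence[where w = b])
      show "r (X n) \<in> borel_measurable \<nu>" for n
        using r_integrable X(1) by (blast intro: borel_measurable_integrable)
      show "integrable \<nu> b" unfolding b_def by (simp add: D_integrable)
      show "AE z in \<nu>. (\<lambda>n. r (X n) z) \<longlonglongrightarrow> 0"
        using r_lim X unfolding tendsto_at_iff_sequentially o_def by (intro AE_I2) (simp add: space_\<nu>)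
      show "AE z in \<nu>. norm (r (X n) z) \<le> b z" for n
        using r_bound X(1) by (intro AE_I2) (simp add: space_\<nu>)
    qed simp
    then show "(\<lambda>n. \<integral>z. r (X n) z \<partial>\<nu>) \<longlonglongrightarrow> 0" by simp
  qed
  moreover have "\<forall>\<^sub>F \<eta> in at \<theta> within \<Theta>. (\<integral>z. r \<eta> z \<partial>\<nu>)
      = ((\<integral>x. ev f x \<partial>push \<Omega> \<nu> G \<eta>) - (\<integral>x. ev f x \<partial>push \<Omega> \<nu> G \<theta>)
          - inner (Lop ev \<nu> \<Theta> G \<theta> f) (\<eta> - \<theta>)) /\<^sub>R norm (\<eta> - \<theta>)"
    by (auto simp: eventually_at_filter r_def integral_push assms ev_G_integrable Lop_eq
        ev_G_gradient_integrable intro!: always_eventually)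
  ultimately show "((\<lambda>\<eta>. ((\<integral>x. ev f x \<partial>push \<Omega> \<nu> G \<eta>) - (\<integral>x. ev f x \<partial>push \<Omega> \<nu> G \<theta>)
          - inner (Lop ev \<nu> \<Theta> G \<theta> f) (\<eta> - \<theta>)) /\<^sub>R norm (\<eta> - \<theta>)) \<longlongrightarrow> 0) (at \<theta> within \<Theta>)"
    by (rule Lim_transform_eventually)
qed

text \<open>The difference \<open>u\<close> of the embeddings is tested against itself: its squared
  norm is the difference of the two integrals of the function \<open>u\<close>, which
  \<open>ev_G_lipschitz\<close> bounds by a multiple of the norm of \<open>u\<close>. One factor of
  that norm then cancels.\<close>

lemma mean_embedding_push_lipschitz:
  assumes "\<theta> \<in> \<Theta>" "\<theta>' \<in> \<Theta>"
  shows "norm (mean_embedding \<Omega> ev k (push \<Omega> \<nu> G \<theta>') - mean_embedding \<Omega> ev k (push \<Omega> \<nu> G \<theta>))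
    \<le> Lip * (\<integral>z. D z \<partial>\<nu>) * norm (\<theta>' - \<theta>)"
proof -
  define u where "u = mean_embedding \<Omega> ev k (push \<Omega> \<nu> G \<theta>') - mean_embedding \<Omega> ev k (push \<Omega> \<nu> G \<theta>)"
  have "(norm u)\<^sup>2 = inner u u" by (simp add: power2_norm_eq_inner)
  also have "\<dots> = (\<integral>x. ev u x \<partial>push \<Omega> \<nu> G \<theta>') - (\<integral>x. ev u x \<partial>push \<Omega> \<nu> G \<theta>)"
    by (subst (2) u_def) (simp add: inner_diff_right inner_mean_embedding prob_push sets_push assms)
  also have "\<dots> = (\<integral>z. ev u (G \<theta>' z) - ev u (G \<theta> z) \<partial>\<nu>)"
    by (simp add: integral_push ev_G_integrable assms)
  also have "\<dots> \<le> (\<integral>z. norm u * (Lip * D z) * norm (\<theta>' - \<theta>) \<partial>\<nu>)"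
    using ev_G_lipschitz[OF assms, of _ u]
    by (intro integral_mono) (auto simp: ev_G_integrable assms D_integrable space_\<nu> abs_le_iff)
  also have "\<dots> = norm u * (Lip * (\<integral>z. D z \<partial>\<nu>) * norm (\<theta>' - \<theta>))" by (simp add: mult_ac)
  finally have "norm u * norm u \<le> norm u * (Lip * (\<integral>z. D z \<partial>\<nu>) * norm (\<theta>' - \<theta>))"
    by (simp add: power2_eq_square)
  moreover have "0 \<le> (\<integral>z. D z \<partial>\<nu>)"
    by (rule Bochner_Integration.integral_nonneg) (simp add: space_\<nu> D_nonneg)
  ultimately show ?thesis
    using Lip_pos unfolding u_def[symmetric] by (cases "u = 0") auto
qed

lemma half_square_mmd_has_derivative:
  fixes p
  assumes "\<theta> \<in> \<Theta>" and p: "prob_space p" "sets p = sets (restrict_space borel \<Omega>)"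
  defines "m \<equiv> mean_embedding \<Omega> ev k p - mean_embedding \<Omega> ev k (push \<Omega> \<nu> G \<theta>)"
  shows "((\<lambda>\<eta>. 1/2 * (mmd \<Omega> ev k p (push \<Omega> \<nu> G \<eta>))\<^sup>2)
    has_derivative (\<lambda>h. - inner (Lop ev \<nu> \<Theta> G \<theta> m) h)) (at \<theta> within \<Theta>)"
proof -
  define \<mu> where "\<mu> \<eta> = mean_embedding \<Omega> ev k (push \<Omega> \<nu> G \<eta>)" for \<eta>
  define C where "C = Lip * (\<integral>z. D z \<partial>\<nu>)"
  \<comment> \<open>Since \<open>m\<close> is frozen at \<open>\<theta>\<close>, \<open>I\<close>
    integrates one fixed function against a varying measure and
    \<open>integral_push_has_derivative\<close> applies.\<close>
  define I where "I \<eta> = (\<integral>x. ev m x \<partial>push \<Omega> \<nu> G \<eta>)" for \<eta>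
  \<comment> \<open>The squared increment is of second order by the Lipschitz bound, hence has
    derivative zero.\<close>
  have sq: "((\<lambda>\<eta>. 1/2 * (norm (\<mu> \<eta> - \<mu> \<theta>))\<^sup>2) has_derivative (\<lambda>h. 0)) (at \<theta> within \<Theta>)"
  proof (rule has_derivativeI_sandwich[where e = 1 and H = "\<lambda>\<eta>. 1/2 * C\<^sup>2 * norm (\<eta> - \<theta>)"])
    fix \<eta> assume \<eta>: "\<eta> \<in> \<Theta>" "\<eta> \<noteq> \<theta>"
    have "(norm (\<mu> \<eta> - \<mu> \<theta>))\<^sup>2 \<le> (C * norm (\<eta> - \<theta>))\<^sup>2"
      unfolding \<mu>_def C_def by (intro power_mono mean_embedding_push_lipschitz assms \<eta>) auto
    then show "norm (1/2 * (norm (\<mu> \<eta> - \<mu> \<theta>))\<^sup>2 - 1/2 * (norm (\<mu> \<theta> - \<mu> \<theta>))\<^sup>2 - 0) / norm (\<eta> - \<theta>)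
        \<le> 1/2 * C\<^sup>2 * norm (\<eta> - \<theta>)"
      using \<eta> by (simp add: divide_simps power2_eq_square mult_ac)
  next
    have "((\<lambda>\<eta>. 1/2 * C\<^sup>2 * norm (\<eta> - \<theta>)) \<longlongrightarrow> 1/2 * C\<^sup>2 * norm (\<theta> - \<theta>)) (at \<theta> within \<Theta>)"
      by (intro tendsto_intros)
    then show "((\<lambda>\<eta>. 1/2 * C\<^sup>2 * norm (\<eta> - \<theta>)) \<longlongrightarrow> 0) (at \<theta> within \<Theta>)" by simp
  qed auto
  have eq: "1/2 * (mmd \<Omega> ev k p (push \<Omega> \<nu> G \<eta>))\<^sup>2
      = 1/2 * (norm m)\<^sup>2 - (I \<eta> - I \<theta>) + 1/2 * (norm (\<mu> \<eta> - \<mu> \<theta>))\<^sup>2" if "\<eta> \<in> \<Theta>" for \<eta>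
  proof -
    have "I \<eta> - I \<theta> = inner m (\<mu> \<eta> - \<mu> \<theta>)"
      by (simp add: I_def \<mu>_def inner_diff_right inner_mean_embedding prob_push sets_push that assms)
    moreover have "mean_embedding \<Omega> ev k p - \<mu> \<eta> = m - (\<mu> \<eta> - \<mu> \<theta>)" by (simp add: m_def \<mu>_def)
    ultimately show ?thesis
      unfolding mmd_def \<mu>_def[symmetric]
      by (simp add: power2_norm_eq_inner[symmetric] dot_norm_neg algebra_simps)
  qed
  have "((\<lambda>\<eta>. 1/2 * (norm m)\<^sup>2 - (I \<eta> - I \<theta>) + 1/2 * (norm (\<mu> \<eta> - \<mu> \<theta>))\<^sup>2)
      has_derivative (\<lambda>h. 0 - (inner (Lop ev \<nu> \<Theta> G \<theta> m) h - 0) + 0)) (at \<theta> within \<Theta>)"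
    unfolding I_def
    by (intro has_derivative_add has_derivative_diff has_derivative_const sq
        integral_push_has_derivative assms)
  from has_derivative_transform[OF assms(1) eq this] show ?thesis by simp
qed

section \<open>The operator D, the regularized equation and the regularized discrepancy\<close>

lemma Dop_inner:
  assumes "\<theta> \<in> \<Theta>"
  shows "inner f (Dop \<Omega> ev k \<nu> \<Theta> G \<theta> g) = inner (Lop ev \<nu> \<Theta> G \<theta> f) (Lop ev \<nu> \<Theta> G \<theta> g)"
  by (simp add: Dop_def inner_Ladj assms)

text \<open>One direction pairs \<open>D f\<close> with \<open>f\<close>, giving the squared norm of
  \<open>L f\<close>; the other pairs \<open>D f\<close> with itself.\<close>

lemma Dop_eq_0_iff:
  assumes "\<theta> \<in> \<Theta>"
  shows "Dop \<Omega> ev k \<nu> \<Theta> G \<theta> f = 0 \<longleftrightarrow> Lop ev \<nu> \<Theta> G \<theta> f = 0"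
proof
  assume "Dop \<Omega> ev k \<nu> \<Theta> G \<theta> f = 0"
  then show "Lop ev \<nu> \<Theta> G \<theta> f = 0" using Dop_inner[OF assms, of f f] by simp
next
  assume "Lop ev \<nu> \<Theta> G \<theta> f = 0"
  then show "Dop \<Omega> ev k \<nu> \<Theta> G \<theta> f = 0"
    using Dop_inner[OF assms, of "Dop \<Omega> ev k \<nu> \<Theta> G \<theta> f" f] by simp
qed

lemma Ladj_linear:
  assumes "\<theta> \<in> \<Theta>"
  shows "linear (Ladj \<Omega> ev k \<nu> \<Theta> G \<theta>)"
  by (rule linearI; rule vector_eq_ldot[THEN iffD1, rule_format])
    (simp_all add: inner_Ladj assms inner_add_right)

text \<open>Applying \<open>L\<close> to the equation turns it into a linear system in the
  finite-dimensional parameter space for \<open>w = L f\<close>. Its operator \<open>M\<close> is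
  positive definite, hence injective and therefore surjective.\<close>

lemma regularized_equation_unique_solution:
  assumes "\<theta> \<in> \<Theta>" "\<alpha> \<ge> 0" "\<beta> > 0"
  shows "\<exists>!f. \<alpha> *\<^sub>R Dop \<Omega> ev k \<nu> \<Theta> G \<theta> f + \<beta> *\<^sub>R f = m"
proof -
  let ?L = "Lop ev \<nu> \<Theta> G \<theta>" and ?A = "Ladj \<Omega> ev k \<nu> \<Theta> G \<theta>"
  interpret L: bounded_linear ?L by (rule Lop_bounded_linear[OF assms(1)])
  interpret A: linear ?A by (rule Ladj_linear[OF assms(1)])
  define M where "M w = \<alpha> *\<^sub>R ?L (?A w) + \<beta> *\<^sub>R w" for w
  have lin: "linear M"
    by (rule linearI) (simp_all add: M_def A.add A.scaleR L.add L.scaleR algebra_simps)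
  have "w = 0" if "M w = 0" for w
  proof -
    have "\<alpha> * inner (?A w) (?A w) + \<beta> * inner w w = inner (M w) w"
      by (simp add: M_def inner_add inner_Ladj[OF assms(1), of "?A w" w])
    with that have "\<alpha> * inner (?A w) (?A w) + \<beta> * inner w w = 0" by simp
    moreover have "0 \<le> \<alpha> * inner (?A w) (?A w)" using assms by simp
    moreover have "0 \<le> \<beta> * inner w w" using assms by simp
    ultimately have "\<beta> * inner w w = 0" by linarith
    then show ?thesis using assms by simp
  qed
  then have "inj M" using lin by (simp add: linear_injective_0)
  with lin have "surj M" by (rule linear_inj_imp_surj)
  then obtain w where w: "M w = ?L m" by (metis surjD)
  \<comment> \<open>This solves the equation for \<open>f\<close> once \<open>D f\<close> is
    replaced by the adjoint applied to \<open>w\<close>; it remains to check that \<open>L f\<close>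
    is indeed \<open>w\<close>.\<close>
  define f where "f = (1/\<beta>) *\<^sub>R (m - \<alpha> *\<^sub>R ?A w)"
  have "\<beta> *\<^sub>R ?L f = ?L m - \<alpha> *\<^sub>R ?L (?A w)"
    using assms by (simp add: f_def L.scaleR L.diff)
  also have "\<dots> = \<beta> *\<^sub>R w" by (simp add: w[symmetric] M_def)
  finally have "?L f = w" using assms by simp
  then have f: "\<alpha> *\<^sub>R Dop \<Omega> ev k \<nu> \<Theta> G \<theta> f + \<beta> *\<^sub>R f = m"
    using assms by (simp add: Dop_def f_def)
  moreover have "g = f" if "\<alpha> *\<^sub>R Dop \<Omega> ev k \<nu> \<Theta> G \<theta> g + \<beta> *\<^sub>R g = m" for g
  proof -
    \<comment> \<open>The difference of the two equations is tested with \<open>g - f\<close>, which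
      gives a vanishing sum of nonnegative terms.\<close>
    have "0 = inner (g - f) ((\<alpha> *\<^sub>R Dop \<Omega> ev k \<nu> \<Theta> G \<theta> g + \<beta> *\<^sub>R g)
        - (\<alpha> *\<^sub>R Dop \<Omega> ev k \<nu> \<Theta> G \<theta> f + \<beta> *\<^sub>R f))"
      using that f by simp
    also have "\<dots> = \<alpha> * inner (?L (g - f)) (?L (g - f)) + \<beta> * inner (g - f) (g - f)"
      by (simp add: inner_add inner_diff Dop_inner[OF assms(1)] L.diff algebra_simps)
    finally have "\<alpha> * inner (?L (g - f)) (?L (g - f)) + \<beta> * inner (g - f) (g - f) = 0" by simp
    moreover have "0 \<le> \<alpha> * inner (?L (g - f)) (?L (g - f))" using assms by simp
    moreover have "0 \<le> \<beta> * inner (g - f) (g - f)" using assms by simp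
    ultimately have "\<beta> * inner (g - f) (g - f) = 0" by linarith
    then show ?thesis using assms by simp
  qed
  ultimately show ?thesis by blast
qed

text \<open>
  The constraint and the objective are the norm and the inner product of the vectors
  \<open>(\<surd>\<alpha> L f, \<surd>\<beta> f)\<close> in the product space, so the supremum is an instance of Cauchy--Schwarz.
\<close>

lemma mmd_reg_square:
  fixes p
  assumes \<theta>: "\<theta> \<in> \<Theta>" and \<alpha>: "\<alpha> > 0" and \<beta>: "\<beta> > 0"
    and p: "prob_space p" "sets p = sets (restrict_space borel \<Omega>)"
  defines "m \<equiv> mean_embedding \<Omega> ev k p - mean_embedding \<Omega> ev k (push \<Omega> \<nu> G \<theta>)"
  assumes g: "\<alpha> *\<^sub>R Dop \<Omega> ev k \<nu> \<Theta> G \<theta> g + \<beta> *\<^sub>R g = m"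
  shows "(mmd_reg \<Omega> ev \<nu> \<Theta> G \<alpha> \<beta> p \<theta>)\<^sup>2 = 1/2 * inner g m"
proof -
  let ?L = "Lop ev \<nu> \<Theta> G \<theta>"
  interpret L: bounded_linear ?L by (rule Lop_bounded_linear[OF \<theta>])
  define \<Phi> where "\<Phi> f = (sqrt \<alpha> *\<^sub>R ?L f, sqrt \<beta> *\<^sub>R f)" for f
  have \<Phi>_scale: "\<Phi> (c *\<^sub>R f) = c *\<^sub>R \<Phi> f" for c f by (simp add: \<Phi>_def L.scaleR)
  have \<Phi>_inner: "inner (\<Phi> f) (\<Phi> h) = \<alpha> * inner (?L f) (?L h) + \<beta> * inner f h" for f h
    using \<alpha> \<beta> by (simp add: \<Phi>_def inner_prod_def flip: mult.assoc)
  have obj: "(\<integral>x. ev f x \<partial>p) - (\<integral>x. ev f x \<partial>push \<Omega> \<nu> G \<theta>) = inner (\<Phi> f) (\<Phi> g)" for f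
  proof -
    have "(\<integral>x. ev f x \<partial>p) - (\<integral>x. ev f x \<partial>push \<Omega> \<nu> G \<theta>) = inner f m"
      by (simp add: m_def inner_diff_right inner_mean_embedding p prob_push sets_push \<theta>)
    also have "\<dots> = inner (\<Phi> f) (\<Phi> g)"
      by (simp add: g[symmetric] inner_add_right Dop_inner[OF \<theta>] \<Phi>_inner)
    finally show ?thesis .
  qed
  \<comment> \<open>The gradient in the constraint is \<open>L f\<close>, by differentiation under
    the integral and uniqueness of gradients within \<open>\<Theta>\<close>.\<close>
  have E: "Eset \<Omega> ev \<nu> \<Theta> G \<alpha> \<beta> \<theta> = {f. (norm (\<Phi> f))\<^sup>2 \<le> 1/2}"
    unfolding Eset_def
    by (simp add: gradient_within_unique[OF \<theta> integral_push_has_derivative[OF \<theta>]]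
        power2_norm_eq_inner \<Phi>_inner)
  have "mmd_reg \<Omega> ev \<nu> \<Theta> G \<alpha> \<beta> p \<theta> = sqrt (1/2) * norm (\<Phi> g)"
    unfolding mmd_reg_def E obj
  proof (rule cSup_eq_maximum)
    \<comment> \<open>\<open>c = 0\<close> if \<open>\<Phi> g = 0\<close>\<close>
    define c where "c = sqrt (1/2) / norm (\<Phi> g)"
    have "(norm (\<Phi> (c *\<^sub>R g)))\<^sup>2 \<le> 1/2"
      unfolding \<Phi>_scale
      by (cases "\<Phi> g = 0") (simp_all add: c_def power_mult_distrib power_divide)
    moreover have "inner (\<Phi> (c *\<^sub>R g)) (\<Phi> g) = sqrt (1/2) * norm (\<Phi> g)"
      by (simp add: \<Phi>_scale c_def power2_norm_eq_inner[symmetric] power2_eq_square)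
    ultimately show "sqrt (1/2) * norm (\<Phi> g)
        \<in> (\<lambda>f. inner (\<Phi> f) (\<Phi> g)) ` {f. (norm (\<Phi> f))\<^sup>2 \<le> 1/2}"
      by (metis (no_types, lifting) image_iff mem_Collect_eq)
  next
    fix y assume "y \<in> (\<lambda>f. inner (\<Phi> f) (\<Phi> g)) ` {f. (norm (\<Phi> f))\<^sup>2 \<le> 1/2}"
    then obtain f where f: "(norm (\<Phi> f))\<^sup>2 \<le> 1/2" "y = inner (\<Phi> f) (\<Phi> g)" by blast
    from f(1) have "norm (\<Phi> f) \<le> sqrt (1/2)" by (rule real_le_rsqrt)
    then have "norm (\<Phi> f) * norm (\<Phi> g) \<le> sqrt (1/2) * norm (\<Phi> g)" by (rule mult_right_mono) simp
    then show "y \<le> sqrt (1/2) * norm (\<Phi> g)" using norm_cauchy_schwarz[of "\<Phi> f" "\<Phi> g"] f(2) by linarith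
  qed
  moreover have "(norm (\<Phi> g))\<^sup>2 = inner g m"
    by (simp add: power2_norm_eq_inner \<Phi>_inner g[symmetric] inner_add_right Dop_inner[OF \<theta>])
  ultimately show ?thesis by (simp add: power_mult_distrib)
qed

end

section \<open>Decay along the dynamic\<close>

theorem theorem6:
  fixes \<Omega> :: "(real^'d) set"
    and ev :: "'h::{real_inner, complete_space} \<Rightarrow> real^'d \<Rightarrow> real"
    and k :: "real^'d \<Rightarrow> real^'d \<Rightarrow> real"
    and Z :: "(real^'m) set"
    and \<nu> :: "(real^'m) measure"
    and \<Theta> :: "(real^'n) set"
    and G :: "real^'n \<Rightarrow> real^'m \<Rightarrow> real^'d"
    and Lip :: real
    and D :: "real^'m \<Rightarrow> real"
    and \<alpha> \<beta> :: real
    and p :: "(real^'d) measure"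
    and T :: "real set"
    and \<theta> :: "real \<Rightarrow> real^'n"
    and F :: "real^'n \<Rightarrow> real"
  assumes setting: "generator_setting \<Omega> ev k Z \<nu> \<Theta> G Lip D"
    and \<alpha>: "\<alpha> > 0" and \<beta>: "\<beta> > 0"
    and p: "prob_space p" "sets p = sets (restrict_space borel \<Omega>)"
    and F: "\<And>\<eta>. F \<eta> = 1/2 * (mmd \<Omega> ev k p (push \<Omega> \<nu> G \<eta>))\<^sup>2"
    and T: "is_interval T"
    and \<theta>_in: "\<And>t. t \<in> T \<Longrightarrow> \<theta> t \<in> \<Theta>"
    and dynamic: "\<And>t. t \<in> T \<Longrightarrow>
      (\<theta> has_vector_derivative
         Lop ev \<nu> \<Theta> G (\<theta> t) (witness \<Omega> ev k \<nu> \<Theta> G \<alpha> \<beta> p (\<theta> t))) (at t within T)"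
  shows "\<forall>t\<in>T. \<exists>F'.
      ((\<lambda>s. F (\<theta> s)) has_real_derivative F') (at t within T) \<and>
      F' = - (2 / \<alpha>) * (F (\<theta> t) - \<beta> * (mmd_reg \<Omega> ev \<nu> \<Theta> G \<alpha> \<beta> p (\<theta> t))\<^sup>2) \<and>
      F' \<le> 0 \<and>
      (F' < 0 \<longleftrightarrow>
         Dop \<Omega> ev k \<nu> \<Theta> G (\<theta> t)
           (mean_embedding \<Omega> ev k p - mean_embedding \<Omega> ev k (push \<Omega> \<nu> G (\<theta> t))) \<noteq> 0)"
proof
  fix t assume t: "t \<in> T"
  interpret generator_setting \<Omega> ev k Z \<nu> \<Theta> G Lip D by (rule setting)
  note \<theta>t = \<theta>_in[OF t]
  let ?L = "Lop ev \<nu> \<Theta> G (\<theta> t)" and ?Dop = "Dop \<Omega> ev k \<nu> \<Theta> G (\<theta> t)"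
  interpret L: bounded_linear ?L by (rule Lop_bounded_linear[OF \<theta>t])
  define m where "m = mean_embedding \<Omega> ev k p - mean_embedding \<Omega> ev k (push \<Omega> \<nu> G (\<theta> t))"
  define f where "f = witness \<Omega> ev k \<nu> \<Theta> G \<alpha> \<beta> p (\<theta> t)"
  \<comment> \<open>Unique solvability ensures that the description defining \<open>witness\<close>
    denotes a solution.\<close>
  have f: "\<alpha> *\<^sub>R ?Dop f + \<beta> *\<^sub>R f = m"
    using theI'[OF regularized_equation_unique_solution[OF \<theta>t less_imp_le[OF \<alpha>] \<beta>, of m]]
    unfolding f_def witness_def m_def .
  define F' where "F' = - inner (?L m) (?L f)"
  have "((\<lambda>s. F (\<theta> s)) has_derivative (\<lambda>h. - inner (?L m) (h *\<^sub>R ?L f))) (at t within T)"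
  proof -
    have "(\<theta> has_derivative (\<lambda>h. h *\<^sub>R ?L f)) (at t within T)"
      using dynamic[OF t] by (simp add: has_vector_derivative_def f_def)
    \<comment> \<open>The chain rule asks for a derivative of \<open>F\<close> within the image of
      the path; the path stays in \<open>\<Theta>\<close>, so the derivative within
      \<open>\<Theta>\<close> restricts to it.\<close>
    moreover have "(F has_derivative (\<lambda>h. - inner (?L m) h)) (at (\<theta> t) within \<theta> ` T)"
      using half_square_mmd_has_derivative[OF \<theta>t p] \<theta>_in
      unfolding F[abs_def] m_def by (blast intro: has_derivative_subset)
    ultimately show ?thesis by (rule has_derivative_in_compose)
  qed
  moreover have "(\<lambda>h. - inner (?L m) (h *\<^sub>R ?L f)) = (*) F'" by (auto simp: F'_def)
  ultimately have deriv: "((\<lambda>s. F (\<theta> s)) has_real_derivative F') (at t within T)"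
    by (simp only: has_field_derivative_def)
  \<comment> \<open>The adjoint relation moves \<open>L\<close> off \<open>m\<close>; then
    \<open>m\<close> is replaced by the left side of the equation for \<open>f\<close>.\<close>
  have F'_norms: "F' = - (\<alpha> * (norm (?Dop f))\<^sup>2 + \<beta> * (norm (?L f))\<^sup>2)"
  proof -
    have "inner (?L m) (?L f) = inner m (?Dop f)" by (simp add: Dop_inner[OF \<theta>t])
    also have "\<dots> = \<alpha> * inner (?Dop f) (?Dop f) + \<beta> * inner f (?Dop f)"
      by (simp add: f[symmetric] inner_add_left)
    finally show ?thesis by (simp add: F'_def power2_norm_eq_inner Dop_inner[OF \<theta>t, of f f])
  qed
  \<comment> \<open>Pairing the equation for \<open>f\<close> with \<open>m\<close> gives that
    \<open>2 F\<close> is \<open>- \<alpha> F'\<close> plus \<open>2 \<beta>\<close> times the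
    squared regularized discrepancy.\<close>
  have "F' = - (2 / \<alpha>) * (F (\<theta> t) - \<beta> * (mmd_reg \<Omega> ev \<nu> \<Theta> G \<alpha> \<beta> p (\<theta> t))\<^sup>2)"
  proof -
    have "F (\<theta> t) = 1/2 * inner m m" by (simp add: F mmd_def m_def power2_norm_eq_inner)
    moreover have "(mmd_reg \<Omega> ev \<nu> \<Theta> G \<alpha> \<beta> p (\<theta> t))\<^sup>2 = 1/2 * inner f m"
      using mmd_reg_square[OF \<theta>t \<alpha> \<beta> p, of f] f unfolding m_def by blast
    moreover have "inner m m = inner m (\<alpha> *\<^sub>R ?Dop f + \<beta> *\<^sub>R f)" by (simp add: f)
    then have "inner m m = \<alpha> * inner (?L m) (?L f) + \<beta> * inner f m"
      by (simp add: inner_add_right Dop_inner[OF \<theta>t] inner_commute)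
    ultimately show ?thesis using \<alpha> by (simp add: F'_def field_simps)
  qed
  moreover have "F' \<le> 0" using \<alpha> \<beta> unfolding F'_norms neg_le_0_iff_le
    by (intro add_nonneg_nonneg mult_nonneg_nonneg) simp_all
  moreover have "F' < 0 \<longleftrightarrow> ?Dop m \<noteq> 0"
  proof -
    \<comment> \<open>If \<open>F'\<close> vanishes, \<open>F'_norms\<close> forces
      \<open>L f = 0\<close> and so \<open>D f = 0\<close>; the equation then reduces to
      \<open>m = \<beta> f\<close>, whence \<open>L m = 0\<close>.\<close>
    have "F' = 0 \<longleftrightarrow> ?L m = 0"
    proof
      assume "F' = 0"
      moreover have "0 \<le> \<alpha> * (norm (?Dop f))\<^sup>2" "0 \<le> \<beta> * (norm (?L f))\<^sup>2" using \<alpha> \<beta> by simp_all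
      ultimately have "\<beta> * (norm (?L f))\<^sup>2 = 0" unfolding F'_norms by linarith
      then have Lf: "?L f = 0" using \<beta> by simp
      then have "?Dop f = 0" by (simp add: Dop_eq_0_iff[OF \<theta>t])
      with f have "m = \<beta> *\<^sub>R f" by simp
      with Lf show "?L m = 0" by (simp add: L.scaleR)
    qed (simp add: F'_def)
    with \<open>F' \<le> 0\<close> show ?thesis by (auto simp: Dop_eq_0_iff[OF \<theta>t])
  qed
  ultimately show "\<exists>F'. ((\<lambda>s. F (\<theta> s)) has_real_derivative F') (at t within T) \<and>
      F' = - (2 / \<alpha>) * (F (\<theta> t) - \<beta> * (mmd_reg \<Omega> ev \<nu> \<Theta> G \<alpha> \<beta> p (\<theta> t))\<^sup>2) \<and>
      F' \<le> 0 \<and>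
      (F' < 0 \<longleftrightarrow>
         Dop \<Omega> ev k \<nu> \<Theta> G (\<theta> t)
           (mean_embedding \<Omega> ev k p - mean_embedding \<Omega> ev k (push \<Omega> \<nu> G (\<theta> t))) \<noteq> 0)"
    using deriv unfolding m_def by blast
qed

end
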